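(* Let $K$ be a field, let $G=(V,E)$ be a directed acyclic graph with a single source vertex $s$ and a single sink vertex $t$, and let $M=(\{W_v\}_{v\in V},\{f_e\}_{e\in E})$ be a commutative $G$-module over $K$. Identify $\lim(M)$ with $W_s$ and $\operatorname{colim}(M)$ with $W_t$ via the canonical maps $\eta_s:\lim(M)\to W_s$ and $\iota_t:W_t\to\operatorname{colim}(M)$, so that the persistence $P(M)$ is a subspace of $W_t$, namely the image of the induced $K$-linear morphism $\varphi: W_s\to W_t$. Then $$P(M)=\alpha_{W_s}^{W_s}(W_t),$$ where the morphisms $g:W_s\to W_t$ occurring in the description of the preradical $\alpha_{W_s}^{W_s}$ are taken within the $G$-module representation; that is, $$\alpha_{W_s}^{W_s}(W_t)=\sum\{\,g(W_s)\mid g=f_\gamma:W_s\to W_t \text{ for some directed path } \gamma \text{ from } s \text{ to } t \text{ in } G\,\}.$$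
   Context: Graphs are finite and simple. A source is a vertex with no incoming edge; a sink is a vertex with no outgoing edge. Commutative $G$-module: for a directed acyclic graph $G=(V,E)$ and a field $K$, a commutative $G$-module $M=(\{W_v\}_{v\in V},\{f_e\}_{e\in E})$ assigns to each vertex $v$ a $K$-vector space $W_v$ and to each edge $e=(u,v)$ (from $u$ to $v$) a $K$-linear map $f_e:W_u\to W_v$. For a directed path $\gamma=e_1,\dots,e_n$ put $f_\gamma=f_{e_n}\circ\cdots\circ f_{e_1}$ (the identity for a trivial path). Commutativity requires $f_\gamma=f_{\gamma'}$ whenever $\gamma,\gamma'$ are directed paths with the same starting vertex and the same ending vertex. $M$ is viewed as a diagram in the category $K$-Mod, with limit cone $(\lim(M),\{\eta_v:\lim(M)\to W_v\}_{v\in V})$ and colimit cocone $(\operatorname{colim}(M),\{\iota_v:W_v\to\operatorname{colim}(M)\}_{v\in V})$. Persistence: the induced morphism is $\varphi_M:\lim(M)\to\operatorname{colim}(M)$, $\varphi_M=\iota_v\circ\eta_v$ for any $v\in V$, and the persistence of $M$ is $P(M)=\varphi_M(\lim(M))$. For a single-source single-sink graph, $\eta_s$ and $\iota_t$ are isomorphisms. Preradical $\alpha$: for a $K$-module $A$ and a submodule $N\subseteq A$, $\alpha_N^A(W)=\sum\{f(N)\mid f\in\operatorname{Hom}(A,W)\}$; in this statement the set of morphisms is restricted to those arising in the $G$-module representation, i.e. the maps $f_\gamma$ along directed paths. *)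

theory Defs
  imports
    "Graph_Theory.Graph_Theory"
    "Jordan_Normal_Form.Missing_VectorSpace"
begin

section \<open>Commutative modules over a directed acyclic graph\<close>

text \<open>The locale \<^locale>\<open>digraph\<close> of \<^theory>\<open>Graph_Theory.Digraph\<close> describes finite digraphs without
  loops and without multiple arcs.\<close>

locale dag = digraph +
  assumes acyclic: "\<nexists>p. cycle p"

definition sources :: "('v, 'e) pre_digraph \<Rightarrow> 'v set" where
  "sources G = {v \<in> verts G. in_arcs G v = {}}"

definition sinks :: "('v, 'e) pre_digraph \<Rightarrow> 'v set" where
  "sinks G = {v \<in> verts G. out_arcs G v = {}}"

text \<open>\<open>path_map f [e\<^sub>1, \<dots>, e\<^sub>n] = f e\<^sub>n \<circ> \<dots> \<circ> f e\<^sub>1\<close>, and \<open>path_map f [] = id\<close>.\<close>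

definition path_map :: "('e \<Rightarrow> 'b \<Rightarrow> 'b) \<Rightarrow> 'e list \<Rightarrow> 'b \<Rightarrow> 'b" where
  "path_map f \<gamma> = fold f \<gamma>"

text \<open>A directed path is a sequence of composable arcs (\<^const>\<open>pre_digraph.awalk\<close>); in an acyclic
  graph such a walk never repeats a vertex. The spaces \<open>W v\<close> are arbitrary vector spaces whose
  elements are drawn from one common type. The values of \<open>f e\<close> outside the carrier of its domain
  are irrelevant.\<close>

locale commutative_G_module = dag G
  for G :: "('v, 'e) pre_digraph" (structure) +
  fixes K :: "'k ring"
    and W :: "'v \<Rightarrow> ('k, 'b) module"
    and f :: "'e \<Rightarrow> 'b \<Rightarrow> 'b"
  assumes field_K: "field K"
    and vectorspace_W: "v \<in> verts G \<Longrightarrow> vectorspace K (W v)"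
    and linear_f: "e \<in> arcs G \<Longrightarrow> f e \<in> module_hom K (W (tail G e)) (W (head G e))"
    and commutative: "\<lbrakk>awalk u \<gamma> v; awalk u \<gamma>' v; x \<in> carrier (W u)\<rbrakk>
      \<Longrightarrow> path_map f \<gamma> x = path_map f \<gamma>' x"

section \<open>Limit and colimit in the category of vector spaces over \<open>K\<close>\<close>

text \<open>The type \<open>'b\<close> plays the role of the universe: objects of the category are the vector spaces
  over \<open>K\<close> with carrier in \<open>'b\<close>. A morphism out of \<open>T\<close> is a linear map taken up to its values
  outside \<open>carrier T\<close>, which is why uniqueness is expressed with \<^const>\<open>extensional\<close> functions.\<close>

definition is_cone ::
  "('v, 'e) pre_digraph \<Rightarrow> 'k ring \<Rightarrow> ('v \<Rightarrow> ('k, 'b) module) \<Rightarrow> ('e \<Rightarrow> 'b \<Rightarrow> 'b)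
    \<Rightarrow> ('k, 'b) module \<Rightarrow> ('v \<Rightarrow> 'b \<Rightarrow> 'b) \<Rightarrow> bool" where
  "is_cone G K W f T \<tau> \<longleftrightarrow>
     vectorspace K T \<and>
     (\<forall>v\<in>verts G. \<tau> v \<in> module_hom K T (W v)) \<and>
     (\<forall>e\<in>arcs G. \<forall>x\<in>carrier T. f e (\<tau> (tail G e) x) = \<tau> (head G e) x)"

definition is_limit ::
  "('v, 'e) pre_digraph \<Rightarrow> 'k ring \<Rightarrow> ('v \<Rightarrow> ('k, 'b) module) \<Rightarrow> ('e \<Rightarrow> 'b \<Rightarrow> 'b)
    \<Rightarrow> ('k, 'b) module \<Rightarrow> ('v \<Rightarrow> 'b \<Rightarrow> 'b) \<Rightarrow> bool" where
  "is_limit G K W f L \<eta> \<longleftrightarrow>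
     is_cone G K W f L \<eta> \<and>
     (\<forall>T \<tau>. is_cone G K W f T \<tau> \<longrightarrow>
        (\<exists>!h. h \<in> module_hom K T L \<inter> extensional (carrier T) \<and>
              (\<forall>v\<in>verts G. \<forall>x\<in>carrier T. \<eta> v (h x) = \<tau> v x)))"

definition is_cocone ::
  "('v, 'e) pre_digraph \<Rightarrow> 'k ring \<Rightarrow> ('v \<Rightarrow> ('k, 'b) module) \<Rightarrow> ('e \<Rightarrow> 'b \<Rightarrow> 'b)
    \<Rightarrow> ('k, 'b) module \<Rightarrow> ('v \<Rightarrow> 'b \<Rightarrow> 'b) \<Rightarrow> bool" where
  "is_cocone G K W f T \<tau> \<longleftrightarrow>
     vectorspace K T \<and>
     (\<forall>v\<in>verts G. \<tau> v \<in> module_hom K (W v) T) \<and>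
     (\<forall>e\<in>arcs G. \<forall>x\<in>carrier (W (tail G e)). \<tau> (head G e) (f e x) = \<tau> (tail G e) x)"

definition is_colimit ::
  "('v, 'e) pre_digraph \<Rightarrow> 'k ring \<Rightarrow> ('v \<Rightarrow> ('k, 'b) module) \<Rightarrow> ('e \<Rightarrow> 'b \<Rightarrow> 'b)
    \<Rightarrow> ('k, 'b) module \<Rightarrow> ('v \<Rightarrow> 'b \<Rightarrow> 'b) \<Rightarrow> bool" where
  "is_colimit G K W f C \<iota> \<longleftrightarrow>
     is_cocone G K W f C \<iota> \<and>
     (\<forall>T \<tau>. is_cocone G K W f T \<tau> \<longrightarrow>
        (\<exists>!h. h \<in> module_hom K C T \<inter> extensional (carrier C) \<and>
              (\<forall>v\<in>verts G. \<forall>x\<in>carrier (W v). h (\<iota> v x) = \<tau> v x)))"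

section \<open>Persistence\<close>

text \<open>The induced morphism from the limit to the colimit, computed at a vertex \<open>v\<close>. It does not
  depend on \<open>v\<close> when the graph has a single source; statements about it should hold for every \<open>v\<close>.\<close>

definition induced_morphism :: "('v \<Rightarrow> 'b \<Rightarrow> 'b) \<Rightarrow> ('v \<Rightarrow> 'b \<Rightarrow> 'b) \<Rightarrow> 'v \<Rightarrow> 'b \<Rightarrow> 'b" where
  "induced_morphism \<eta> \<iota> v = \<iota> v \<circ> \<eta> v"

definition persistence ::
  "('k, 'b) module \<Rightarrow> ('v \<Rightarrow> 'b \<Rightarrow> 'b) \<Rightarrow> ('v \<Rightarrow> 'b \<Rightarrow> 'b) \<Rightarrow> 'v \<Rightarrow> 'b set" where
  "persistence L \<eta> \<iota> v = induced_morphism \<eta> \<iota> v ` carrier L"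

section \<open>The preradical\<close>

text \<open>Sum of a family of submodules of \<open>W\<close>: all finite sums of elements taken from members of the
  family.\<close>

definition sum_submodules :: "('k, 'b) module \<Rightarrow> 'b set set \<Rightarrow> 'b set" where
  "sum_submodules W \<N> =
     {finsum W x F | x F. finite F \<and> F \<subseteq> \<N> \<and> (\<forall>N\<in>F. x N \<in> N)}"

text \<open>The preradical \<open>\<alpha>\<^sub>N\<^sup>A\<close> evaluated at \<open>W\<close>, with the morphisms restricted to the set \<open>H\<close>; the
  unrestricted preradical is \<open>preradical_alpha UNIV K A N W\<close>.\<close>

definition preradical_alpha ::
  "('a \<Rightarrow> 'b) set \<Rightarrow> 'k ring \<Rightarrow> ('k, 'a) module \<Rightarrow> 'a set \<Rightarrow> ('k, 'b) module \<Rightarrow> 'b set" where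
  "preradical_alpha H K A N W = sum_submodules W {g ` N | g. g \<in> module_hom K A W \<and> g \<in> H}"

definition path_morphisms ::
  "('v, 'e) pre_digraph \<Rightarrow> ('e \<Rightarrow> 'b \<Rightarrow> 'b) \<Rightarrow> 'v \<Rightarrow> 'v \<Rightarrow> ('b \<Rightarrow> 'b) set" where
  "path_morphisms G f u v = {path_map f \<gamma> | \<gamma>. pre_digraph.awalk G u \<gamma> v}"

end

theory Submission
  imports Defs
begin

text \<open>Acyclicity and finiteness give a path from \<open>s\<close> to every vertex and from every vertex to \<open>t\<close>.
  By commutativity the path maps out of \<open>s\<close> form a cone with apex \<open>W s\<close> and those into \<open>t\<close> a
  cocone with apex \<open>W t\<close>. The universal properties make the mediating morphisms inverse to
  \<open>\<eta> s\<close> and \<open>\<iota> t\<close>, and identify the induced morphism with the path map from \<open>s\<close> to \<open>t\<close>.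
  Hence the preradical is a sum over a family with the single member \<open>P\<close>.\<close>

section \<open>Closure properties of linear maps\<close>

lemma module_hom_comp:
  assumes "g \<in> module_hom K A B" and "h \<in> module_hom K B D"
  shows "h \<circ> g \<in> module_hom K A D"
  using assms by (auto simp: module_hom_def Pi_iff)

lemma module_hom_id: "id \<in> module_hom K A A"
  by (auto simp: module_hom_def)

text \<open>Mediating morphisms are unique only among extensional maps, so composites have to be
  restricted before uniqueness applies. The module structure of \<open>A\<close> keeps sums and
  scalar multiples inside the carrier, where restriction changes nothing.\<close>

lemma module_hom_restrict:
  assumes "module K A" and "g \<in> module_hom K A B"
  shows "restrict g (carrier A) \<in> module_hom K A B"
proof -
  interpret module K A by fact
  show ?thesis
    using assms(2) by (auto simp: module_hom_def)
qed

section \<open>Reachability in a finite acyclic graph\<close>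

context dag
begin

text \<open>A nonempty closed walk contains a cycle. This form of acyclicity, together with
  finiteness, gives well-founded induction along arcs in both directions.\<close>

lemma acyclic_arcs_ends: "acyclic (arcs_ends G)"
proof (rule acyclicI, rule allI, rule notI)
  fix u
  assume "u \<rightarrow>\<^sup>+ u"
  then obtain p where "awalk u p u" "p \<noteq> []"
    by (auto simp: reachable1_awalk)
  then have "closed_w p"
    by (auto simp: closed_w_def)
  then show False
    using closed_w_imp_cycle acyclic by blast
qed

lemma finite_arcs_ends: "finite (arcs_ends G)"
  by (simp add: arcs_ends_def)

text \<open>Well-founded induction along arcs: a vertex other than \<open>s\<close> is not a source,
  so it has an incoming arc, and the tail of that arc is already reachable from
  \<open>s\<close>.\<close>

lemma awalk_from_source:
  assumes "sources G = {s}" and "v \<in> verts G"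
  shows "\<exists>\<gamma>. awalk s \<gamma> v"
proof -
  have "wf (arcs_ends G)"
    using finite_arcs_ends acyclic_arcs_ends by (rule finite_acyclic_wf)
  then show ?thesis
    using assms(2)
  proof (induction v rule: wf_induct_rule)
    case (less v)
    show ?case
    proof (cases "v = s")
      case True
      then show ?thesis
        using less.prems awalk_Nil_iff by blast
    next
      case False
      then have "v \<notin> sources G"
        using assms(1) by simp
      then obtain e where e: "e \<in> arcs G" "head G e = v"
        using less.prems unfolding sources_def by (auto simp: in_arcs_def)
      then have "(tail G e, v) \<in> arcs_ends G" "tail G e \<in> verts G"
        using in_arcs_imp_in_arcs_ends by auto
      with less.IH obtain \<gamma> where "awalk s \<gamma> (tail G e)"
        by blast
      moreover have "awalk (tail G e) [e] v"
        using e by (auto simp: awalk_simps)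
      ultimately show ?thesis
        using awalk_appendI by blast
    qed
  qed
qed

lemma awalk_to_sink:
  assumes "sinks G = {t}" and "v \<in> verts G"
  shows "\<exists>\<gamma>. awalk v \<gamma> t"
proof -
  have "wf ((arcs_ends G)\<inverse>)"
    using finite_arcs_ends acyclic_arcs_ends by (rule finite_acyclic_wf_converse)
  then show ?thesis
    using assms(2)
  proof (induction v rule: wf_induct_rule)
    case (less v)
    show ?case
    proof (cases "v = t")
      case True
      then show ?thesis
        using less.prems awalk_Nil_iff by blast
    next
      case False
      then have "v \<notin> sinks G"
        using assms(1) by simp
      then obtain e where e: "e \<in> arcs G" "tail G e = v"
        using less.prems unfolding sinks_def by (auto simp: out_arcs_def)
      then have "(head G e, v) \<in> (arcs_ends G)\<inverse>" "head G e \<in> verts G"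
        using in_arcs_imp_in_arcs_ends by auto
      with less.IH obtain \<gamma> where "awalk (head G e) \<gamma> t"
        by blast
      then have "awalk v (e # \<gamma>) t"
        using e by (auto simp: awalk_simps)
      then show ?thesis
        by blast
    qed
  qed
qed

end

section \<open>Path maps and the canonical map between two vertices\<close>

context commutative_G_module
begin

lemma path_map_hom:
  "awalk u \<gamma> w \<Longrightarrow> path_map f \<gamma> \<in> module_hom K (W u) (W w)"
proof (induction \<gamma> arbitrary: u)
  case Nil
  then show ?case
    by (simp add: path_map_def awalk_simps module_hom_id[unfolded id_def])
next
  case (Cons e \<gamma>)
  then have "e \<in> arcs G" "u = tail G e" "path_map f \<gamma> \<in> module_hom K (W (head G e)) (W w)"
    by (auto simp: awalk_simps)
  then have "path_map f \<gamma> \<circ> f e \<in> module_hom K (W u) (W w)"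
    using module_hom_comp linear_f by metis
  then show ?case
    by (simp add: path_map_def comp_def)
qed

text \<open>When a path exists, commutativity makes the choice immaterial on the carrier of
  \<open>W u\<close>; naming one map per pair of vertices lets these maps serve as legs of a cone or
  cocone.\<close>

definition transit :: "'v \<Rightarrow> 'v \<Rightarrow> 'b \<Rightarrow> 'b" where
  "transit u w = path_map f (SOME \<gamma>. awalk u \<gamma> w)"

lemma transit_eq:
  assumes "awalk u \<gamma> w" and "x \<in> carrier (W u)"
  shows "transit u w x = path_map f \<gamma> x"
  unfolding transit_def using someI[of "\<lambda>\<gamma>. awalk u \<gamma> w", OF assms(1)] assms
  by (rule commutative)

lemma transit_hom:
  assumes "awalk u \<gamma> w"
  shows "transit u w \<in> module_hom K (W u) (W w)"
  unfolding transit_def using someI[of "\<lambda>\<gamma>. awalk u \<gamma> w", OF assms]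
  by (rule path_map_hom)

lemma transit_self:
  assumes "u \<in> verts G" and "x \<in> carrier (W u)"
  shows "transit u u x = x"
  using transit_eq[of u "[]" u] assms by (simp add: awalk_simps path_map_def)

lemma transit_trans:
  assumes "awalk u \<gamma> v" and "awalk v \<delta> w" and "x \<in> carrier (W u)"
  shows "transit v w (transit u v x) = transit u w x"
proof -
  have "transit u v x \<in> carrier (W v)"
    using transit_hom[OF assms(1)] assms(3) module_hom_closed by blast
  then show ?thesis
    using assms transit_eq[OF awalk_appendI[OF assms(1,2)]]
    by (simp add: transit_eq path_map_def)
qed

lemma transit_arc:
  assumes "e \<in> arcs G" and "x \<in> carrier (W (tail G e))"
  shows "transit (tail G e) (head G e) x = f e x"
  using transit_eq[of "tail G e" "[e]" "head G e"] assms by (simp add: awalk_simps path_map_def)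

lemma awalk_arc: "e \<in> arcs G \<Longrightarrow> awalk (tail G e) [e] (head G e)"
  by (simp add: awalk_simps)

section \<open>Cones, cocones and their universal properties\<close>

lemma cone_along_awalk:
  assumes "is_cone G K W f T \<tau>" and "x \<in> carrier T"
  shows "awalk u \<gamma> w \<Longrightarrow> path_map f \<gamma> (\<tau> u x) = \<tau> w x"
proof (induction \<gamma> arbitrary: u)
  case (Cons e \<gamma>)
  then show ?case
    using assms by (auto simp: is_cone_def path_map_def awalk_simps)
qed (simp add: path_map_def awalk_simps)

lemma cocone_along_awalk:
  assumes "is_cocone G K W f T \<tau>"
  shows "awalk u \<gamma> w \<Longrightarrow> x \<in> carrier (W u) \<Longrightarrow> \<tau> w (path_map f \<gamma> x) = \<tau> u x"
proof (induction \<gamma> arbitrary: u x)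
  case (Cons e \<gamma>)
  then have e: "e \<in> arcs G" "u = tail G e" "awalk (head G e) \<gamma> w"
    by (auto simp: awalk_simps)
  \<comment> \<open>The cocone equations hold on carriers only, and the argument moves along the
    path, so its membership has to be carried through the induction.\<close>
  then have "f e x \<in> carrier (W (head G e))"
    using Cons.prems(2) linear_f module_hom_closed by blast
  with Cons e show ?case
    using assms by (simp add: is_cocone_def path_map_def)
qed (simp add: path_map_def awalk_simps)

text \<open>Every leg exists because \<open>s\<close> reaches every vertex. Appending an arc to a
  path ending at its tail gives a path to its head, whence the legs are compatible.\<close>

lemma is_cone_transit:
  assumes "sources G = {s}"
  shows "is_cone G K W f (W s) (transit s)"
  unfolding is_cone_def
proof (intro conjI ballI)
  show "vectorspace K (W s)"
    using assms by (intro vectorspace_W) (auto simp: sources_def)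
  show "transit s v \<in> module_hom K (W s) (W v)" if "v \<in> verts G" for v
    using awalk_from_source[OF assms that] transit_hom by blast
  fix e x
  assume e: "e \<in> arcs G" and x: "x \<in> carrier (W s)"
  then obtain \<gamma> where \<gamma>: "awalk s \<gamma> (tail G e)"
    using awalk_from_source[OF assms, of "tail G e"] by auto
  then have "transit s (tail G e) x \<in> carrier (W (tail G e))"
    using x transit_hom module_hom_closed by blast
  then show "f e (transit s (tail G e) x) = transit s (head G e) x"
    using transit_trans[OF \<gamma> awalk_arc[OF e] x] transit_arc[OF e] by simp
qed

lemma is_cocone_transit:
  assumes "sinks G = {t}"
  shows "is_cocone G K W f (W t) (\<lambda>v. transit v t)"
  unfolding is_cocone_def
proof (intro conjI ballI)
  show "vectorspace K (W t)"
    using assms by (intro vectorspace_W) (auto simp: sinks_def)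
  show "transit v t \<in> module_hom K (W v) (W t)" if "v \<in> verts G" for v
    using awalk_to_sink[OF assms that] transit_hom by blast
  fix e x
  assume e: "e \<in> arcs G" and x: "x \<in> carrier (W (tail G e))"
  then obtain \<gamma> where \<gamma>: "awalk (head G e) \<gamma> t"
    using awalk_to_sink[OF assms, of "head G e"] by auto
  show "transit (head G e) t (f e x) = transit (tail G e) t x"
    using transit_trans[OF awalk_arc[OF e] \<gamma> x] transit_arc[OF e x] by simp
qed

text \<open>The mediating map \<open>h\<close> of the cone with apex \<open>W s\<close> inverts
  \<open>\<eta> s\<close>: one composite is the map of the trivial path at \<open>s\<close>, the
  other is the identity by uniqueness of the morphism from the limit to itself.\<close>

lemma limit_bij_source:
  assumes "sources G = {s}" and lim: "is_limit G K W f L \<eta>"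
  shows "bij_betw (\<eta> s) (carrier L) (carrier (W s))"
proof -
  have s: "s \<in> verts G"
    using assms(1) by (auto simp: sources_def)
  have cone: "is_cone G K W f L \<eta>"
    using lim by (simp add: is_limit_def)
  have L: "module K L"
    using cone by (simp add: is_cone_def vectorspace_def)
  have \<eta>s: "\<eta> s \<in> module_hom K L (W s)"
    using cone s by (simp add: is_cone_def)
  obtain h where h: "h \<in> module_hom K (W s) L"
    and h_eq: "\<And>v x. v \<in> verts G \<Longrightarrow> x \<in> carrier (W s) \<Longrightarrow> \<eta> v (h x) = transit s v x"
    using lim is_cone_transit[OF assms(1)] unfolding is_limit_def by blast
  let ?mediates = "\<lambda>k. k \<in> module_hom K L L \<inter> extensional (carrier L) \<and>
    (\<forall>v\<in>verts G. \<forall>x\<in>carrier L. \<eta> v (k x) = \<eta> v x)"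
  have "?mediates (restrict id (carrier L))"
    using module_hom_restrict[OF L module_hom_id] by simp
  \<comment> \<open>The component of \<open>h (\<eta> s x)\<close> at \<open>v\<close> is
    \<open>transit s v (\<eta> s x)\<close>, which is \<open>\<eta> v x\<close> by transporting the
    cone along a path from \<open>s\<close> to \<open>v\<close>.\<close>
  moreover have "?mediates (restrict (h \<circ> \<eta> s) (carrier L))"
  proof (intro conjI IntI ballI)
    show "restrict (h \<circ> \<eta> s) (carrier L) \<in> module_hom K L L"
      using module_hom_restrict[OF L module_hom_comp[OF \<eta>s h]] .
    fix v x
    assume v: "v \<in> verts G" and x: "x \<in> carrier L"
    obtain \<gamma> where "awalk s \<gamma> v"
      using awalk_from_source[OF assms(1) v] by blast
    moreover have "\<eta> s x \<in> carrier (W s)"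
      using \<eta>s x module_hom_closed by blast
    ultimately show "\<eta> v (restrict (h \<circ> \<eta> s) (carrier L) x) = \<eta> v x"
      using v x h_eq transit_eq cone_along_awalk[OF cone x] by simp
  qed simp
  moreover have "\<exists>!k. ?mediates k"
    using lim cone by (simp add: is_limit_def)
  ultimately have restrict_eq: "restrict (h \<circ> \<eta> s) (carrier L) = restrict id (carrier L)"
    by blast
  have "h (\<eta> s x) = x" if "x \<in> carrier L" for x
    using fun_cong[OF restrict_eq, of x] that by simp
  moreover have "\<eta> s (h x) = x" if "x \<in> carrier (W s)" for x
    using that h_eq s transit_self by simp
  ultimately show ?thesis
    using module_hom_closed[OF h] module_hom_closed[OF \<eta>s]
    by (intro bij_betw_byWitness[where f' = h]) auto
qed

text \<open>Dual to the limit: \<open>h\<close> now comes from the cocone with apex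
  \<open>W t\<close>, and uniqueness of the morphism from the colimit to itself gives the composite
  on \<open>C\<close>.\<close>

lemma colimit_bij_sink:
  assumes "sinks G = {t}" and colim: "is_colimit G K W f C \<iota>"
  shows "bij_betw (\<iota> t) (carrier (W t)) (carrier C)"
proof -
  have t: "t \<in> verts G"
    using assms(1) by (auto simp: sinks_def)
  have cocone: "is_cocone G K W f C \<iota>"
    using colim by (simp add: is_colimit_def)
  have C: "module K C"
    using cocone by (simp add: is_cocone_def vectorspace_def)
  have \<iota>: "\<iota> v \<in> module_hom K (W v) C" if "v \<in> verts G" for v
    using cocone that by (simp add: is_cocone_def)
  obtain h where h: "h \<in> module_hom K C (W t)"
    and h_eq: "\<And>v x. v \<in> verts G \<Longrightarrow> x \<in> carrier (W v) \<Longrightarrow> h (\<iota> v x) = transit v t x"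
    using colim is_cocone_transit[OF assms(1)] unfolding is_colimit_def by blast
  let ?mediates = "\<lambda>k. k \<in> module_hom K C C \<inter> extensional (carrier C) \<and>
    (\<forall>v\<in>verts G. \<forall>x\<in>carrier (W v). k (\<iota> v x) = \<iota> v x)"
  have \<iota>_closed: "\<iota> v x \<in> carrier C" if "v \<in> verts G" "x \<in> carrier (W v)" for v x
    using \<iota> that module_hom_closed by blast
  have "?mediates (restrict id (carrier C))"
    using module_hom_restrict[OF C module_hom_id] \<iota>_closed by simp
  moreover have "?mediates (restrict (\<iota> t \<circ> h) (carrier C))"
  proof (intro conjI IntI ballI)
    show "restrict (\<iota> t \<circ> h) (carrier C) \<in> module_hom K C C"
      using module_hom_restrict[OF C module_hom_comp[OF h \<iota>[OF t]]] .
    fix v x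
    assume v: "v \<in> verts G" and x: "x \<in> carrier (W v)"
    obtain \<gamma> where "awalk v \<gamma> t"
      using awalk_to_sink[OF assms(1) v] by blast
    then show "restrict (\<iota> t \<circ> h) (carrier C) (\<iota> v x) = \<iota> v x"
      using v x h_eq transit_eq cocone_along_awalk[OF cocone] \<iota>_closed by simp
  qed simp
  moreover have "\<exists>!k. ?mediates k"
    using colim cocone by (simp add: is_colimit_def)
  ultimately have restrict_eq: "restrict (\<iota> t \<circ> h) (carrier C) = restrict id (carrier C)"
    by blast
  have "\<iota> t (h x) = x" if "x \<in> carrier C" for x
    using fun_cong[OF restrict_eq, of x] that by simp
  moreover have "h (\<iota> t x) = x" if "x \<in> carrier (W t)" for x
    using that h_eq t transit_self by simp
  ultimately show ?thesis
    using module_hom_closed[OF h] module_hom_closed[OF \<iota>[OF t]]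
    by (intro bij_betw_byWitness[where f' = h]) auto
qed

text \<open>Push \<open>\<eta> v x\<close> forward along a path to \<open>t\<close> and pull it back
  along a path from \<open>s\<close>; the concatenation is a path from \<open>s\<close> to
  \<open>t\<close>. The right-hand side is free of \<open>v\<close>, so the induced morphism is the
  same at every vertex.\<close>

lemma induced_morphism_eq_transit:
  assumes "sources G = {s}" and "sinks G = {t}" and "v \<in> verts G"
    and cone: "is_cone G K W f L \<eta>" and cocone: "is_cocone G K W f C \<iota>"
    and x: "x \<in> carrier L"
  shows "induced_morphism \<eta> \<iota> v x = \<iota> t (transit s t (\<eta> s x))"
proof -
  obtain \<gamma> \<delta> where \<gamma>: "awalk s \<gamma> v" and \<delta>: "awalk v \<delta> t"
    using awalk_from_source[OF assms(1,3)] awalk_to_sink[OF assms(2,3)] by blast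
  have "\<eta> u x \<in> carrier (W u)" if "u \<in> verts G" for u
    using cone x that module_hom_closed unfolding is_cone_def by blast
  moreover have "s \<in> verts G"
    using assms(1) by (auto simp: sources_def)
  ultimately have \<eta>_closed: "\<eta> s x \<in> carrier (W s)" "\<eta> v x \<in> carrier (W v)"
    using assms(3) by auto
  have "induced_morphism \<eta> \<iota> v x = \<iota> t (path_map f \<delta> (\<eta> v x))"
    using cocone_along_awalk[OF cocone \<delta>] \<eta>_closed by (simp add: induced_morphism_def)
  also have "path_map f \<delta> (\<eta> v x) = path_map f (\<gamma> @ \<delta>) (\<eta> s x)"
    using cone_along_awalk[OF cone x \<gamma>] by (simp add: path_map_def)
  also have "\<dots> = transit s t (\<eta> s x)"
    using transit_eq[OF awalk_appendI[OF \<gamma> \<delta>] \<eta>_closed(1)] by simp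
  finally show ?thesis .
qed

end

section \<open>Sums over a one-member family, and the preradical\<close>

lemma sum_submodules_singleton:
  assumes "abelian_monoid W" and "N \<subseteq> carrier W" and "\<zero>\<^bsub>W\<^esub> \<in> N"
  shows "sum_submodules W {N} = N"
proof -
  interpret abelian_monoid W by fact
  have sum: "finsum W x {N} = x N" if "x N \<in> N" for x
    using finsum_insert[of "{}" N x] that assms(2) by auto
  show ?thesis
  proof (intro equalityI subsetI)
    fix y
    assume "y \<in> sum_submodules W {N}"
    then obtain x F where y: "y = finsum W x F" and F: "F \<subseteq> {N}" "\<forall>N\<in>F. x N \<in> N"
      by (auto simp: sum_submodules_def)
    \<comment> \<open>The empty subfamily contributes the empty sum, which lies in \<open>N\<close>
      because \<open>N\<close> contains zero.\<close>
    then consider "F = {}" | "F = {N}"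
      by blast
    then show "y \<in> N"
      using y F assms(3) sum by cases auto
  next
    fix y
    assume "y \<in> N"
    then show "y \<in> sum_submodules W {N}"
      using sum[of "\<lambda>_. y"] unfolding sum_submodules_def
      by (intro CollectI exI[of _ "\<lambda>_. y"] exI[of _ "{N}"]) simp
  qed
qed

theorem proposition4p1:
  fixes G :: "('v, 'e) pre_digraph"
    and K :: "'k ring"
    and W :: "'v \<Rightarrow> ('k, 'b) module"
    and f :: "'e \<Rightarrow> 'b \<Rightarrow> 'b"
    and s t v :: 'v
    and L C :: "('k, 'b) module"
    and \<eta> \<iota> :: "'v \<Rightarrow> 'b \<Rightarrow> 'b"
    and \<phi> :: "'b \<Rightarrow> 'b"
    and P :: "'b set"
  assumes M: "commutative_G_module G K W f"
    and single_source: "sources G = {s}"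
    and single_sink: "sinks G = {t}"
    and lim: "is_limit G K W f L \<eta>"
    and colim: "is_colimit G K W f C \<iota>"
    and v: "v \<in> verts G"
  defines "\<phi> \<equiv> inv_into (carrier (W t)) (\<iota> t) \<circ> induced_morphism \<eta> \<iota> v \<circ> inv_into (carrier L) (\<eta> s)"
    and "P \<equiv> inv_into (carrier (W t)) (\<iota> t) ` persistence L \<eta> \<iota> v"
  shows "bij_betw (\<eta> s) (carrier L) (carrier (W s))
    \<and> bij_betw (\<iota> t) (carrier (W t)) (carrier C)
    \<and> P = \<phi> ` carrier (W s)
    \<and> P = preradical_alpha (path_morphisms G f s t) K (W s) (carrier (W s)) (W t)
    \<and> preradical_alpha (path_morphisms G f s t) K (W s) (carrier (W s)) (W t)
        = sum_submodules (W t)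
            {g ` carrier (W s) | g. \<exists>\<gamma>. pre_digraph.awalk G s \<gamma> t \<and> g = path_map f \<gamma>}"
proof -
  interpret commutative_G_module G K W f by fact
  have verts: "s \<in> verts G" "t \<in> verts G"
    using single_source single_sink by (auto simp: sources_def sinks_def)
  have cone: "is_cone G K W f L \<eta>" and cocone: "is_cocone G K W f C \<iota>"
    using lim colim by (simp_all add: is_limit_def is_colimit_def)
  have bij_s: "bij_betw (\<eta> s) (carrier L) (carrier (W s))"
    using limit_bij_source[OF single_source lim] .
  have bij_t: "bij_betw (\<iota> t) (carrier (W t)) (carrier C)"
    using colimit_bij_sink[OF single_sink colim] .
  obtain \<gamma> where \<gamma>: "awalk s \<gamma> t"
    using awalk_from_source[OF single_source verts(2)] by blast
  let ?g = "transit s t"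
  have g: "?g \<in> module_hom K (W s) (W t)"
    using transit_hom[OF \<gamma>] .
  have P_\<phi>: "P = \<phi> ` carrier (W s)"
  proof -
    have "inv_into (carrier L) (\<eta> s) ` carrier (W s) = carrier L"
      using bij_betw_inv_into[OF bij_s] by (simp add: bij_betw_def)
    then show ?thesis
      unfolding P_def \<phi>_def persistence_def image_comp[symmetric] by simp
  qed
  \<comment> \<open>The induced morphism factors through \<open>\<iota> t\<close>, which the inverse
    cancels by injectivity.\<close>
  have "inv_into (carrier (W t)) (\<iota> t) (induced_morphism \<eta> \<iota> v x) = ?g (\<eta> s x)"
    if x: "x \<in> carrier L" for x
  proof -
    have "?g (\<eta> s x) \<in> carrier (W t)"
      using x bij_betwE[OF bij_s] module_hom_closed[OF g] by blast
    then show ?thesis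
      using induced_morphism_eq_transit[OF single_source single_sink v cone cocone x] bij_t
      by (simp add: bij_betw_def)
  qed
  then have "P = (\<lambda>x. ?g (\<eta> s x)) ` carrier L"
    unfolding P_def persistence_def image_image by (rule image_cong[OF refl])
  also have "\<dots> = ?g ` carrier (W s)"
    by (simp add: bij_betw_imp_surj_on[OF bij_s, symmetric] image_image)
  finally have P_g: "P = ?g ` carrier (W s)" .
  have image_path: "path_map f \<delta> ` carrier (W s) = P" if "awalk s \<delta> t" for \<delta>
    unfolding P_g using transit_eq[OF that] by (intro image_cong) simp_all
  \<comment> \<open>Commutativity gives all paths the same image \<open>P\<close>; the path
    \<open>\<gamma>\<close> found above shows that the family is nonempty.\<close>
  have family: "{g ` carrier (W s) | g. \<exists>\<gamma>. awalk s \<gamma> t \<and> g = path_map f \<gamma>} = {P}"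
    using image_path \<gamma> by blast
  \<comment> \<open>\<open>path_map_hom\<close> supplies the linearity that this description asks of
    \<open>g\<close>.\<close>
  have family': "{g ` carrier (W s) | g. g \<in> module_hom K (W s) (W t) \<and>
      g \<in> path_morphisms G f s t} = {P}"
    using image_path \<gamma> path_map_hom unfolding path_morphisms_def by blast
  interpret Ws: vectorspace K "W s"
    using vectorspace_W[OF verts(1)] .
  interpret Wt: vectorspace K "W t"
    using vectorspace_W[OF verts(2)] .
  interpret g: mod_hom K "W s" "W t" ?g
    using g by unfold_locales
  have "?g \<zero>\<^bsub>W s\<^esub> = \<zero>\<^bsub>W t\<^esub>"
    by simp
  then have "\<zero>\<^bsub>W t\<^esub> \<in> P"
    unfolding P_g using Ws.zero_closed by (metis imageI)
  moreover have "P \<subseteq> carrier (W t)"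
    unfolding P_g using module_hom_closed[OF g] by blast
  ultimately have "sum_submodules (W t) {P} = P"
    using Wt.abelian_monoid_axioms by (intro sum_submodules_singleton)
  then show ?thesis
    using bij_s bij_t P_\<phi> unfolding preradical_alpha_def family family' by simp
qed

end
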